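(* Let $G=(\mathcal V,\mathcal E)$ be a finite connected graph with edge weight $\lambda$, let $O\in\mathcal V$, let $(X_t)_{t\ge0}$ be the Markov chain on $\mathcal V$ with $X_0=O$ and transition probabilities $$p_{S,T}=\frac{\lambda(S,T)}{\sum_{U\sim S}\lambda(S,U)},$$ and let $f_i\in\ell^2_\lambda(\mathcal E)$ be an edge flow. Then the function $\Phi_{f_i}:\mathcal V\to\mathbb{R}$, $$\Phi_{f_i}(T)=\mathbb{E}\Bigl[\sum_{t=1}^{\tau_T}f_i(X_{t-1},X_t)\Bigr],$$ is the unique solution of Poisson's equation $$\mathrm{L}\Phi_{f_i}=\mathrm{d}^*f_i\quad\text{with the initial condition}\quad\Phi_{f_i}(O)=0.$$
   Context: Graph: $\mathcal V$ is a finite set of states. $\mathcal E$ is a set of forward (oriented) edges $(S,T)$ with $S\ne T$, $\mathcal E_-=\{(T,S) : (S,T)\in\mathcal E\}$ is the set of reverse edges, with $\mathcal E\cap\mathcal E_-=\emptyset$, and $\overline{\mathcal E}=\mathcal E\cup\mathcal E_-$. The edge weight $\lambda$ satisfies $\lambda(S,T)=\lambda(T,S)\ge0$ for all $S,T\in\mathcal V$, and $(S,T)\in\overline{\mathcal E}$ if and only if $\lambda(S,T)>0$. Write $T\sim S$ if $\lambda(S,T)>0$. (The transition probabilities presuppose that every state has at least one neighbor.) Edge flows: $\ell^2_\lambda(\mathcal E)$ is the space of functions $f:\overline{\mathcal E}\to\mathbb{R}$ with $f(T,S)=-f(S,T)$, with inner product $\langle f,g\rangle_\lambda=\sum_{(S,T)\in\mathcal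 E}\lambda(S,T)f(S,T)g(S,T)$. $\ell^2(\mathcal V)$ is the space of functions $\mathcal V\to\mathbb{R}$ with inner product $\langle u,v\rangle=\sum_{S\in\mathcal V}u(S)v(S)$. Operators: the gradient $\mathrm{d}:\ell^2(\mathcal V)\to\ell^2_\lambda(\mathcal E)$ is $\mathrm{d}v(S,T)=v(T)-v(S)$; the divergence $\mathrm{d}^*:\ell^2_\lambda(\mathcal E)\to\ell^2(\mathcal V)$ is its adjoint, explicitly $\mathrm{d}^*f(S)=\sum_{T\sim S}\lambda(T,S)f(T,S)$; the Laplacian is $\mathrm{L}=\mathrm{d}^*\mathrm{d}$, explicitly $\mathrm{L}v(S)=\sum_{T\sim S}\lambda(S,T)\bigl(v(S)-v(T)\bigr)$. Stopping time: for $T\in\mathcal V$, $\tau_T=\min\{t\ge1 : X_t=T\}$ is the first time $t\ge1$ at which the process $(X_t)$, started at $X_0=O$, visits $T$ (in particular, $\tau_O$ is the first return time to $O$). $p_{S,T}=0$ when $T\not\sim S$. *)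

theory Defs
  imports "HOL-Probability.Probability"
begin

text \<open>The finite state set is the type \<open>'v::finite\<close>. The set \<open>E\<close> contains the forward
  edges only; the symmetric edge set is \<open>sym_edges E\<close>.\<close>

definition sym_edges :: "('v \<times> 'v) set \<Rightarrow> ('v \<times> 'v) set" where
  "sym_edges E = E \<union> E\<inverse>"

locale weighted_graph =
  fixes E :: "('v::finite \<times> 'v) set" and lam :: "'v \<Rightarrow> 'v \<Rightarrow> real"
  assumes no_loops: "(S, T) \<in> E \<Longrightarrow> S \<noteq> T"
    and oriented: "E \<inter> E\<inverse> = {}"
    and lam_sym: "lam S T = lam T S"
    and lam_nonneg: "lam S T \<ge> 0"
    and sym_edges_iff: "(S, T) \<in> sym_edges E \<longleftrightarrow> lam S T > 0"

definition connected_graph :: "('v \<times> 'v) set \<Rightarrow> bool" where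
  "connected_graph E \<longleftrightarrow> (\<forall>S T. (S, T) \<in> (sym_edges E)\<^sup>*)"

definition nbrs :: "('v \<Rightarrow> 'v \<Rightarrow> real) \<Rightarrow> 'v \<Rightarrow> 'v set" where
  "nbrs lam S = {T. lam S T > 0}"

text \<open>A flow is a function on \<open>sym_edges E\<close>. As HOL functions are total, it also has values
  at pairs that are not edges; these are unconstrained.\<close>

definition edge_flow :: "('v \<times> 'v) set \<Rightarrow> ('v \<Rightarrow> 'v \<Rightarrow> real) \<Rightarrow> bool" where
  "edge_flow E f \<longleftrightarrow> (\<forall>(S, T) \<in> sym_edges E. f T S = - f S T)"

definition flow_inner ::
    "('v \<times> 'v) set \<Rightarrow> ('v \<Rightarrow> 'v \<Rightarrow> real) \<Rightarrow> ('v \<Rightarrow> 'v \<Rightarrow> real) \<Rightarrow> ('v \<Rightarrow> 'v \<Rightarrow> real) \<Rightarrow> real" where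
  "flow_inner E lam f g = (\<Sum>(S, T)\<in>E. lam S T * f S T * g S T)"

definition state_inner :: "('v::finite \<Rightarrow> real) \<Rightarrow> ('v \<Rightarrow> real) \<Rightarrow> real" where
  "state_inner u v = (\<Sum>S\<in>UNIV. u S * v S)"

definition gradient :: "('v \<Rightarrow> real) \<Rightarrow> 'v \<Rightarrow> 'v \<Rightarrow> real" where
  "gradient v S T = v T - v S"

definition divergence :: "('v \<Rightarrow> 'v \<Rightarrow> real) \<Rightarrow> ('v \<Rightarrow> 'v \<Rightarrow> real) \<Rightarrow> 'v \<Rightarrow> real" where
  "divergence lam f S = (\<Sum>T\<in>nbrs lam S. lam T S * f T S)"

definition laplacian :: "('v \<Rightarrow> 'v \<Rightarrow> real) \<Rightarrow> ('v \<Rightarrow> real) \<Rightarrow> 'v \<Rightarrow> real" where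
  "laplacian lam v = divergence lam (gradient v)"

lemma edge_flow_gradient: "edge_flow E (gradient v)"
  by (auto simp: edge_flow_def gradient_def)

context weighted_graph
begin

lemma laplacian_explicit: "laplacian lam v S = (\<Sum>T\<in>nbrs lam S. lam S T * (v S - v T))"
  unfolding laplacian_def divergence_def gradient_def by (intro sum.cong) (auto simp: lam_sym)

lemma divergence_adjoint:
  assumes f: "edge_flow E f"
  shows "flow_inner E lam (gradient v) f = state_inner v (divergence lam f)"
proof -
  have flip: "f T S = - f S T" if "(S, T) \<in> E" for S T
    using f that by (auto simp: edge_flow_def sym_edges_def)
  have nb: "{(S, T). T \<in> nbrs lam S} = E \<union> E\<inverse>"
    using sym_edges_iff by (auto simp: nbrs_def sym_edges_def)
  have "state_inner v (divergence lam f)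
      = (\<Sum>(S, T)\<in>(SIGMA S:UNIV. nbrs lam S). v S * lam T S * f T S)"
    by (simp add: state_inner_def divergence_def sum_distrib_left mult.assoc sum.Sigma)
  also have "(SIGMA S:UNIV. nbrs lam S) = E \<union> E\<inverse>"
    using nb by auto
  also have "(\<Sum>(S, T)\<in>E \<union> E\<inverse>. v S * lam T S * f T S)
      = (\<Sum>(S, T)\<in>E. v S * lam T S * f T S) + (\<Sum>(S, T)\<in>E\<inverse>. v S * lam T S * f T S)"
    by (rule sum.union_disjoint) (use oriented in auto)
  also have "(\<Sum>(S, T)\<in>E\<inverse>. v S * lam T S * f T S) = (\<Sum>(S, T)\<in>E. v T * lam S T * f S T)"
    by (rule sum.reindex_bij_witness[of _ prod.swap prod.swap]) auto
  also have "(\<Sum>(S, T)\<in>E. v S * lam T S * f T S) = (\<Sum>(S, T)\<in>E. - v S * lam S T * f S T)"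
    by (rule sum.cong) (auto simp: flip lam_sym)
  finally show ?thesis
    by (simp add: flow_inner_def gradient_def sum.distrib[symmetric] split_def algebra_simps)
qed

end

definition trans_prob :: "('v \<Rightarrow> 'v \<Rightarrow> real) \<Rightarrow> 'v \<Rightarrow> 'v \<Rightarrow> real" where
  "trans_prob lam S T = lam S T / (\<Sum>U\<in>nbrs lam S. lam S U)"

text \<open>A process on an arbitrary probability space is a Markov chain with transition matrix \<open>p\<close>
  and initial state \<open>s0\<close> if, given any history of positive probability, the conditional
  distribution of the next state is the row of \<open>p\<close> at the current state.\<close>

definition markov_chain ::
    "'w measure \<Rightarrow> (nat \<Rightarrow> 'w \<Rightarrow> 'v) \<Rightarrow> 'v \<Rightarrow> ('v \<Rightarrow> 'v \<Rightarrow> real) \<Rightarrow> bool" where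
  "markov_chain M X s0 p \<longleftrightarrow>
     prob_space M \<and>
     (\<forall>t. X t \<in> measurable M (count_space UNIV)) \<and>
     (AE \<omega> in M. X 0 \<omega> = s0) \<and>
     (\<forall>n x T. \<P>(\<omega> in M. \<forall>i\<le>n. X i \<omega> = x i) > 0 \<longrightarrow>
        \<P>(\<omega> in M. X (Suc n) \<omega> = T \<bar> \<forall>i\<le>n. X i \<omega> = x i) = p (x n) T)"

text \<open>The first visit at a time \<open>t \<ge> 1\<close>; it is \<open>\<infinity>\<close> on paths with no such visit.\<close>

definition visit_time :: "(nat \<Rightarrow> 'w \<Rightarrow> 'v) \<Rightarrow> 'v \<Rightarrow> 'w \<Rightarrow> enat" where
  "visit_time X T \<omega> = (INF t\<in>{t. t \<ge> 1 \<and> X t \<omega> = T}. enat t)"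

text \<open>On the event that \<open>visit_time X T \<omega> = \<infinity>\<close> the following sum has an infinite
  index set and is \<open>0\<close> by convention.\<close>

definition path_sum :: "('v \<Rightarrow> 'v \<Rightarrow> real) \<Rightarrow> (nat \<Rightarrow> 'w \<Rightarrow> 'v) \<Rightarrow> 'v \<Rightarrow> 'w \<Rightarrow> real" where
  "path_sum f X T \<omega> =
     (\<Sum>t | 1 \<le> t \<and> enat t \<le> visit_time X T \<omega>. f (X (t - 1) \<omega>) (X t \<omega>))"

definition path_potential ::
    "'w measure \<Rightarrow> (nat \<Rightarrow> 'w \<Rightarrow> 'v) \<Rightarrow> ('v \<Rightarrow> 'v \<Rightarrow> real) \<Rightarrow> 'v \<Rightarrow> real" where
  "path_potential M X f T = (\<integral>\<omega>. path_sum f X T \<omega> \<partial>M)"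

end

theory Submission imports Defs
begin

text \<open>
  The key is that Poisson's equation turns the path sum into a telescoping sum plus a martingale.
  Suppose that \<open>u\<close> solves \<open>L u = d* f\<close> with \<open>u s0 = 0\<close>, and put \<open>g = f - d u\<close>. Then
  \<open>d* g = 0\<close>, which says precisely that the increment \<open>g (X n) (X (n + 1))\<close> has conditional mean
  zero given the past (\<open>expected_flow\<close>). Hence the path sum of \<open>g\<close> up to the first visit to \<open>T\<close>
  has expectation zero (\<open>expected_path_sum_eq_0\<close>), whereas the path sum of \<open>d u\<close> telescopes to
  \<open>u T - u s0 = u T\<close> (\<open>path_sum_gradient\<close>). So the path potential of \<open>f\<close> is equal to \<open>u\<close>
  (\<open>path_potential_eq\<close>). This gives uniqueness, and it gives the equation itself as soon as some
  solution is known to exist. The return to the starting state is not a special case: there the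
  telescoping sum is \<open>u s0 - u s0 = 0\<close>.

  Existence is linear algebra (\<open>poisson_solvable\<close>): by connectedness the kernel of the Laplacian
  consists of the constants, and therefore its range is the hyperplane of functions with sum zero,
  which contains every divergence.

  The interchange of sum and expectation requires the first visit to have finite mean, that is,
  the probabilities of no visit to \<open>T\<close> up to time \<open>n\<close> to be summable
  (\<open>summable_unvisited\<close>). This follows from solvability once more: for a suitable right-hand side
  there is a function \<open>w \<ge> 0\<close> that decreases on average by one in each step taken outside
  \<open>T\<close>, and the total decrease is bounded by the initial value.
\<close>

section \<open>Poisson's equation on a connected weighted graph\<close>

definition deg :: "('v \<Rightarrow> 'v \<Rightarrow> real) \<Rightarrow> 'v \<Rightarrow> real" where
  "deg lam S = (\<Sum>U\<in>nbrs lam S. lam S U)"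

context weighted_graph
begin

text \<open>Adjointness, tested against a constant function, whose gradient vanishes.\<close>

lemma sum_divergence_eq_0:
  assumes "edge_flow E f"
  shows "(\<Sum>S\<in>UNIV. divergence lam f S) = 0"
  using divergence_adjoint[OF assms, of "\<lambda>_. 1"]
  by (simp add: state_inner_def flow_inner_def gradient_def)

lemma sum_laplacian_eq_0: "(\<Sum>S\<in>UNIV. laplacian lam u S) = 0"
  unfolding laplacian_def by (rule sum_divergence_eq_0[OF edge_flow_gradient])

text \<open>If \<open>L u = 0\<close> then the Dirichlet energy \<open><d u, d u> = <u, L u>\<close> vanishes, so \<open>u\<close> does not
  change along any edge.\<close>

lemma laplacian_kernel_constant:
  assumes "connected_graph E" and "\<And>S. laplacian lam u S = 0"
  shows "u S = u T"
proof -
  have "flow_inner E lam (gradient u) (gradient u) = 0"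
    using divergence_adjoint[OF edge_flow_gradient, of u u] assms(2)
    by (simp add: state_inner_def laplacian_def)
  then have zero: "\<forall>e\<in>E. (case e of (S, T) \<Rightarrow> lam S T * gradient u S T * gradient u S T) = 0"
    unfolding flow_inner_def
    by (subst (asm) sum_nonneg_eq_0_iff)
       (auto simp: mult.assoc intro!: mult_nonneg_nonneg[OF lam_nonneg])
  have fwd: "u S = u T" if "(S, T) \<in> E" for S T
  proof -
    have "lam S T > 0"
      using that sym_edges_iff by (auto simp: sym_edges_def)
    with zero that show ?thesis by (force simp: gradient_def)
  qed
  have edge: "u S = u T" if "(S, T) \<in> sym_edges E" for S T
    using that fwd by (fastforce simp: sym_edges_def)
  have "(S, T) \<in> (sym_edges E)\<^sup>*"
    using assms(1) by (auto simp: connected_graph_def)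
  then show ?thesis
    by (induction rule: rtrancl_induct) (auto dest: edge)
qed

text \<open>Adding the value at \<open>s0\<close> to the equation at \<open>s0\<close> makes the Laplacian an injective, hence
  surjective, endomorphism. Summation over all states shows that for a right-hand side of sum
  zero the added term is zero, so that the original equation is solved with the normalization at
  \<open>s0\<close>.\<close>

lemma poisson_solvable:
  assumes conn: "connected_graph E" and b: "(\<Sum>S\<in>UNIV. b S) = 0"
  obtains u where "laplacian lam u = b" and "u s0 = 0"
proof -
  define F :: "real ^ 'v \<Rightarrow> real ^ 'v" where
    "F x = (\<chi> S. laplacian lam (($) x) S + (if S = s0 then x $ s0 else 0))" for x
  have sumF: "(\<Sum>S\<in>UNIV. F x $ S) = x $ s0" for x
    by (simp add: F_def sum.distrib sum_laplacian_eq_0)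
  have "linear F"
    by (rule linearI)
       (auto simp: F_def vec_eq_iff laplacian_explicit sum.distrib[symmetric] sum_distrib_left
             algebra_simps intro!: sum.cong)
  moreover have "inj F"
  proof (rule linear_injective_0[OF \<open>linear F\<close>, THEN iffD2], intro allI impI)
    fix x assume "F x = 0"
    then have x0: "x $ s0 = 0"
      using sumF[of x] by simp
    have "laplacian lam (($) x) S = 0" for S
      using \<open>F x = 0\<close> x0 by (auto simp: F_def vec_eq_iff split: if_splits)
    from laplacian_kernel_constant[OF conn this, of _ s0] x0 show "x = 0"
      by (simp add: vec_eq_iff)
  qed
  ultimately have "surj F"
    using linear_injective_imp_surjective by blast
  then obtain x where x: "F x = (\<chi> S. b S)"
    by (metis surjD)
  then have x0: "x $ s0 = 0"
    using sumF[of x] b by simp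
  show ?thesis
  proof
    show "laplacian lam (($) x) = b"
      using x x0 by (auto simp: F_def vec_eq_iff fun_eq_iff split: if_splits)
    show "x $ s0 = 0" by (rule x0)
  qed
qed

lemma deg_pos:
  assumes "nbrs lam S \<noteq> {}"
  shows "deg lam S > 0"
  using assms unfolding deg_def by (intro sum_pos) (auto simp: nbrs_def)

lemma sum_trans_prob:
  "(\<Sum>T\<in>UNIV. trans_prob lam S T * c T) = (\<Sum>T\<in>nbrs lam S. lam S T * c T) / deg lam S"
proof -
  have "(\<Sum>T\<in>UNIV. trans_prob lam S T * c T) = (\<Sum>T\<in>nbrs lam S. trans_prob lam S T * c T)"
    using lam_nonneg
    by (intro sum.mono_neutral_right) (auto simp: nbrs_def trans_prob_def order_less_le)
  then show ?thesis
    by (simp add: trans_prob_def deg_def sum_divide_distrib)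
qed

lemma expected_drop:
  "(\<Sum>T\<in>UNIV. trans_prob lam S T * (w S - w T)) = laplacian lam w S / deg lam S"
  by (simp add: sum_trans_prob laplacian_explicit)

text \<open>The divergence counts flow into \<open>S\<close>, while a step of the walk leaves \<open>S\<close>; antisymmetry of the
  flow and symmetry of the weights account for the sign. So \<open>f\<close> has divergence zero exactly if the
  walk gains nothing from it on average.\<close>

lemma expected_flow:
  assumes "edge_flow E f"
  shows "(\<Sum>T\<in>UNIV. trans_prob lam S T * f S T) = - divergence lam f S / deg lam S"
proof -
  have "(\<Sum>T\<in>nbrs lam S. lam S T * f S T) = (\<Sum>T\<in>nbrs lam S. - (lam T S * f T S))"
  proof (intro sum.cong refl)
    fix T assume "T \<in> nbrs lam S"
    then have "(S, T) \<in> sym_edges E"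
      by (simp add: nbrs_def sym_edges_iff)
    with assms have "f T S = - f S T"
      by (auto simp: edge_flow_def)
    then show "lam S T * f S T = - (lam T S * f T S)"
      by (simp add: lam_sym[of S T])
  qed
  then show ?thesis
    by (simp add: sum_trans_prob divergence_def sum_negf)
qed

end

section \<open>One step of a finite Markov chain\<close>

text \<open>The product form of the Markov property holds for histories of probability zero as well,
  where conditioning is meaningless: there both sides vanish.\<close>

lemma markov_chain_history:
  assumes "markov_chain M X s0 p"
  shows "\<P>(\<omega> in M. X (Suc n) \<omega> = T \<and> (\<forall>i\<le>n. X i \<omega> = x i))
       = \<P>(\<omega> in M. \<forall>i\<le>n. X i \<omega> = x i) * p (x n) T"
proof -
  interpret prob_space M
    using assms by (simp add: markov_chain_def)
  have [measurable]: "X t \<in> measurable M (count_space UNIV)" for t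
    using assms by (simp add: markov_chain_def)
  show ?thesis
  proof (cases "\<P>(\<omega> in M. \<forall>i\<le>n. X i \<omega> = x i) = 0")
    case True
    have "\<P>(\<omega> in M. X (Suc n) \<omega> = T \<and> (\<forall>i\<le>n. X i \<omega> = x i))
        \<le> \<P>(\<omega> in M. \<forall>i\<le>n. X i \<omega> = x i)"
      by (intro finite_measure_mono) auto
    with True show ?thesis
      by (simp add: measure_le_0_iff)
  next
    case False
    then have "\<P>(\<omega> in M. X (Suc n) \<omega> = T \<bar> \<forall>i\<le>n. X i \<omega> = x i) = p (x n) T"
      using assms by (simp add: markov_chain_def zero_less_measure_iff)
    with False show ?thesis
      by (simp add: cond_prob_def field_simps)
  qed
qed

text \<open>On an event decided by \<open>X 0, ..., X n\<close>, a function of \<open>X n\<close> and \<open>X (n + 1)\<close> may be averaged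
  over the next state. As the state space is finite, there are only finitely many histories up to
  time \<open>n\<close>, and both sides are finite sums over these. Restricting the path to \<open>{..n}\<close> makes the histories
  elements of a finite set of functions.\<close>

lemma markov_chain_step:
  fixes X :: "nat \<Rightarrow> 'w \<Rightarrow> 'v::finite" and \<phi> :: "'v \<Rightarrow> 'v \<Rightarrow> real"
  assumes mc: "markov_chain M X s0 p"
  defines "H \<equiv> \<lambda>n \<omega>. restrict (\<lambda>i. X i \<omega>) {..n}"
  shows "(\<integral>\<omega>. of_bool (Q (H n \<omega>)) * \<phi> (X n \<omega>) (X (Suc n) \<omega>) \<partial>M)
       = (\<integral>\<omega>. of_bool (Q (H n \<omega>)) * (\<Sum>T\<in>UNIV. p (X n \<omega>) T * \<phi> (X n \<omega>) T) \<partial>M)"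
proof -
  interpret prob_space M
    using mc by (simp add: markov_chain_def)
  have [measurable]: "X t \<in> measurable M (count_space UNIV)" for t
    using mc by (simp add: markov_chain_def)
  define K :: "(nat \<Rightarrow> 'v) set" where "K = (\<Pi>\<^sub>E i\<in>{..n}. UNIV)"
  have fin: "finite K"
    unfolding K_def by (intro finite_PiE) auto
  have HK: "H n \<omega> \<in> K" for \<omega>
    by (simp add: H_def K_def)
  have H_eq: "H n \<omega> = h \<longleftrightarrow> (\<forall>i\<le>n. X i \<omega> = h i)" if "h \<in> K" for h \<omega>
    using that by (auto simp: H_def K_def fun_eq_iff restrict_def PiE_def extensional_def)
  have H_n: "H n \<omega> n = X n \<omega>" for \<omega>
    by (simp add: H_def)
  define B where "B h = {\<omega> \<in> space M. \<forall>i\<le>n. X i \<omega> = h i}" for h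
  define C where "C h T = {\<omega> \<in> space M. X (Suc n) \<omega> = T \<and> (\<forall>i\<le>n. X i \<omega> = h i)}" for h T
  have [measurable]: "B h \<in> sets M" "C h T \<in> sets M" for h T
    unfolding B_def C_def by measurable
  have BC: "prob (C h T) = prob (B h) * p (h n) T" for h T
    unfolding B_def C_def by (rule markov_chain_history[OF mc])
  have expand_B: "F (H n \<omega>) = (\<Sum>h\<in>K. F h * indicator (B h) \<omega>)"
    if "\<omega> \<in> space M" for F :: "_ \<Rightarrow> real" and \<omega>
  proof -
    have "indicator (B h) \<omega> = (if h = H n \<omega> then 1 else 0 :: real)" if "h \<in> K" for h
      using H_eq[OF that, of \<omega>] \<open>\<omega> \<in> space M\<close> by (auto simp: B_def indicator_def)
    then have "(\<Sum>h\<in>K. F h * indicator (B h) \<omega>) = (\<Sum>h\<in>K. if h = H n \<omega> then F h else 0)"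
      by (intro sum.cong) auto
    then show ?thesis using fin HK by simp
  qed
  have expand_C: "F (H n \<omega>) (X (Suc n) \<omega>) = (\<Sum>h\<in>K. \<Sum>T\<in>UNIV. F h T * indicator (C h T) \<omega>)"
    if "\<omega> \<in> space M" for F :: "_ \<Rightarrow> 'v \<Rightarrow> real" and \<omega>
  proof -
    have "(\<Sum>T\<in>UNIV. F h T * indicator (C h T) \<omega>) = F h (X (Suc n) \<omega>) * indicator (B h) \<omega>" for h
    proof -
      have "(\<Sum>T\<in>UNIV. F h T * indicator (C h T) \<omega>)
          = (\<Sum>T\<in>UNIV. if T = X (Suc n) \<omega> then F h T * indicator (B h) \<omega> else 0)"
        using that by (intro sum.cong) (auto simp: B_def C_def indicator_def)
      then show ?thesis by simp
    qed
    then show ?thesis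
      using expand_B[OF that, of "\<lambda>h. F h (X (Suc n) \<omega>)"] by simp
  qed
  have "(\<integral>\<omega>. of_bool (Q (H n \<omega>)) * \<phi> (X n \<omega>) (X (Suc n) \<omega>) \<partial>M)
      = (\<integral>\<omega>. (\<Sum>h\<in>K. \<Sum>T\<in>UNIV. (of_bool (Q h) * \<phi> (h n) T) * indicator (C h T) \<omega>) \<partial>M)"
    by (intro Bochner_Integration.integral_cong refl)
       (subst expand_C[symmetric], simp_all add: H_n)
  also have "\<dots> = (\<Sum>h\<in>K. \<Sum>T\<in>UNIV. (of_bool (Q h) * \<phi> (h n) T) * prob (C h T))"
    by (intro has_bochner_integral_integral_eq has_bochner_integral_sum
          has_bochner_integral_mult_right has_bochner_integral_real_indicator)
       (simp_all add: less_top[symmetric])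
  also have "\<dots> = (\<Sum>h\<in>K. (of_bool (Q h) * (\<Sum>T\<in>UNIV. p (h n) T * \<phi> (h n) T)) * prob (B h))"
    by (simp add: BC sum_distrib_left sum_distrib_right mult_ac)
  also have "\<dots> = (\<integral>\<omega>. (\<Sum>h\<in>K. (of_bool (Q h) * (\<Sum>T\<in>UNIV. p (h n) T * \<phi> (h n) T))
                          * indicator (B h) \<omega>) \<partial>M)"
    by (intro sym[OF has_bochner_integral_integral_eq] has_bochner_integral_sum
          has_bochner_integral_mult_right has_bochner_integral_real_indicator)
       (simp_all add: less_top[symmetric])
  also have "\<dots> = (\<integral>\<omega>. of_bool (Q (H n \<omega>)) * (\<Sum>T\<in>UNIV. p (X n \<omega>) T * \<phi> (X n \<omega>) T) \<partial>M)"
    by (intro Bochner_Integration.integral_cong refl)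
       (subst expand_B[symmetric], simp_all add: H_n)
  finally show ?thesis .
qed

section \<open>The walk up to its first visit\<close>

text \<open>The event that the step from time \<open>n\<close> to time \<open>n + 1\<close> still belongs to the path up to the first
  visit. A visit at time \<open>0\<close> does not count.\<close>

definition unvisited :: "(nat \<Rightarrow> 'w \<Rightarrow> 'v) \<Rightarrow> 'v \<Rightarrow> nat \<Rightarrow> 'w \<Rightarrow> bool" where
  "unvisited X T n \<omega> \<longleftrightarrow> (\<forall>i\<in>{1..n}. X i \<omega> \<noteq> T)"

lemma unvisited_iff: "unvisited X T n \<omega> \<longleftrightarrow> enat (Suc n) \<le> visit_time X T \<omega>"
  unfolding unvisited_def visit_time_def
  by (auto simp: le_INF_iff not_less_eq_eq[symmetric])

lemma visit_time_finite_iff: "visit_time X T \<omega> < \<infinity> \<longleftrightarrow> (\<exists>n. \<not> unvisited X T n \<omega>)"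
proof (cases "visit_time X T \<omega>")
  case (enat m)
  then show ?thesis by (auto simp: unvisited_iff intro!: exI[of _ m])
qed (simp add: unvisited_iff)

lemma path_sum_unvisited:
  "path_sum f X T \<omega> = (\<Sum>n | unvisited X T n \<omega>. f (X n \<omega>) (X (Suc n) \<omega>))"
  unfolding path_sum_def
  by (rule sum.reindex_bij_witness[of _ Suc "\<lambda>t. t - 1"]) (auto simp: unvisited_iff)

lemma unvisited_lessThan:
  assumes "visit_time X T \<omega> < \<infinity>"
  obtains m where "m \<ge> 1" "X m \<omega> = T" "{n. unvisited X T n \<omega>} = {..<m}"
proof -
  have ex: "\<exists>t. t \<ge> 1 \<and> X t \<omega> = T"
    using assms unfolding visit_time_finite_iff unvisited_def by auto
  define m where "m = (LEAST t. t \<ge> 1 \<and> X t \<omega> = T)"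
  have m: "m \<ge> 1" "X m \<omega> = T"
    using LeastI_ex[OF ex] by (auto simp: m_def)
  moreover have "unvisited X T n \<omega> \<longleftrightarrow> n < m" for n
  proof
    assume "unvisited X T n \<omega>"
    with m show "n < m"
      by (auto simp: unvisited_def not_le[symmetric])
  next
    assume "n < m"
    then have "\<not> (i \<ge> 1 \<and> X i \<omega> = T)" if "i \<le> n" for i
      using that unfolding m_def by (intro not_less_Least) auto
    then show "unvisited X T n \<omega>"
      by (auto simp: unvisited_def)
  qed
  then have "{n. unvisited X T n \<omega>} = {..<m}"
    by auto
  ultimately show ?thesis by (rule that)
qed

lemma path_sum_gradient:
  assumes "visit_time X T \<omega> < \<infinity>"
  shows "path_sum (gradient u) X T \<omega> = u T - u (X 0 \<omega>)"
proof -
  obtain m where "X m \<omega> = T" "{n. unvisited X T n \<omega>} = {..<m}"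
    using unvisited_lessThan[OF assms] by blast
  then show ?thesis
    using sum_lessThan_telescope[of "\<lambda>n. u (X n \<omega>)" m]
    by (simp add: path_sum_unvisited gradient_def)
qed

section \<open>Expected path sums of the random walk\<close>

locale network_walk = weighted_graph E lam + prob_space M
  for E :: "('v::finite \<times> 'v) set" and lam :: "'v \<Rightarrow> 'v \<Rightarrow> real" and M :: "'w measure" +
  fixes X :: "nat \<Rightarrow> 'w \<Rightarrow> 'v" and s0 :: 'v
  assumes connected: "connected_graph E"
    and nbrs_nonempty: "nbrs lam S \<noteq> {}"
    and chain: "markov_chain M X s0 (trans_prob lam)"
begin

lemma X_measurable [measurable]: "X t \<in> measurable M (count_space UNIV)"
  using chain by (simp add: markov_chain_def)

lemma unvisited_measurable [measurable]: "Measurable.pred M (unvisited X T n)"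
  unfolding unvisited_def by measurable

lemma bounded_integrable:
  fixes \<phi> :: "'v \<Rightarrow> 'v \<Rightarrow> real"
  shows "integrable M (\<lambda>\<omega>. of_bool (unvisited X T k \<omega>) * \<phi> (X n \<omega>) (X m \<omega>))"
proof (rule integrable_const_bound)
  show "AE \<omega> in M. norm (of_bool (unvisited X T k \<omega>) * \<phi> (X n \<omega>) (X m \<omega>))
      \<le> Max (range (\<lambda>(S, S'). \<bar>\<phi> S S'\<bar>))"
  proof (rule AE_I2)
    fix \<omega>
    have "\<bar>\<phi> (X n \<omega>) (X m \<omega>)\<bar> \<le> Max (range (\<lambda>(S, S'). \<bar>\<phi> S S'\<bar>))"
      by (rule Max_ge) (auto intro!: image_eqI[of _ _ "(X n \<omega>, X m \<omega>)"])
    then show "norm (of_bool (unvisited X T k \<omega>) * \<phi> (X n \<omega>) (X m \<omega>))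
      \<le> Max (range (\<lambda>(S, S'). \<bar>\<phi> S S'\<bar>))"
      by (auto simp: of_bool_def)
  qed
qed measurable

lemma expectation_unvisited:
  "(\<integral>\<omega>. (of_bool (unvisited X T n \<omega>) :: real) \<partial>M) = \<P>(\<omega> in M. unvisited X T n \<omega>)"
proof -
  have "(\<integral>\<omega>. (of_bool (unvisited X T n \<omega>) :: real) \<partial>M)
      = (\<integral>\<omega>. indicator {\<omega> \<in> space M. unvisited X T n \<omega>} \<omega> \<partial>M)"
    by (intro Bochner_Integration.integral_cong) (auto simp: indicator_def)
  then show ?thesis by simp
qed

text \<open>The event \<open>unvisited X T n\<close> is decided by the first \<open>n\<close> steps, so the increment of the
  \<open>(n + 1)\<close>-st step may be averaged over the neighbours of the current state.\<close>

lemma unvisited_step: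
  "(\<integral>\<omega>. of_bool (unvisited X T n \<omega>) * \<phi> (X n \<omega>) (X (Suc n) \<omega>) \<partial>M)
 = (\<integral>\<omega>. of_bool (unvisited X T n \<omega>)
       * (\<Sum>S'\<in>UNIV. trans_prob lam (X n \<omega>) S' * \<phi> (X n \<omega>) S') \<partial>M)"
proof -
  have "unvisited X T n \<omega> \<longleftrightarrow> (\<forall>i\<in>{1..n}. restrict (\<lambda>i. X i \<omega>) {..n} i \<noteq> T)" for \<omega>
    by (simp add: unvisited_def)
  then show ?thesis
    using markov_chain_step[OF chain, of "\<lambda>h. \<forall>i\<in>{1..n}. h i \<noteq> T" n \<phi>]
    by (simp only:)
qed

text \<open>This bounds the mean of the first visit time by a drift argument. The function \<open>w\<close> solves
  \<open>L w = deg\<close> outside \<open>T\<close>, so that it decreases on average by one in each step that starts outside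
  \<open>T\<close>. The probability of being unvisited at time \<open>n \<ge> 1\<close> is then at most the difference of two
  consecutive terms of a nonnegative sequence \<open>e\<close>. The first step is left out, because the walk
  may start in \<open>T\<close>.\<close>

lemma summable_unvisited: "summable (\<lambda>n. \<P>(\<omega> in M. unvisited X T n \<omega>))"
proof -
  define D where "D = (\<Sum>S\<in>UNIV. deg lam S)"
  have "(\<Sum>S\<in>UNIV. deg lam S - (if S = T then D else 0)) = 0"
    by (simp add: sum_subtractf D_def)
  \<comment> \<open>A solution exists only for a right-hand side of sum zero, so the total \<open>D\<close> is taken off at
    \<open>T\<close>, where none of the steps counted below begins.\<close>
  from poisson_solvable[OF connected this] obtain v
    where v: "laplacian lam v = (\<lambda>S. deg lam S - (if S = T then D else 0))" by blast
  define w where "w S = v S - Min (range v)" for S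
  have w_nonneg: "w S \<ge> 0" for S
    by (simp add: w_def)
  have "laplacian lam w S = laplacian lam v S" for S
    by (simp add: laplacian_explicit w_def)
  then have drop: "(\<Sum>S'\<in>UNIV. trans_prob lam S S' * (w S - w S')) = 1" if "S \<noteq> T" for S
    using that deg_pos[OF nbrs_nonempty, of S] by (simp add: expected_drop v)
  define e where "e n = (\<integral>\<omega>. of_bool (unvisited X T n \<omega>) * w (X n \<omega>) \<partial>M)" for n
  have e_nonneg: "e n \<ge> 0" for n
    unfolding e_def by (intro Bochner_Integration.integral_nonneg) (simp add: w_nonneg)
  have step: "\<P>(\<omega> in M. unvisited X T (Suc n) \<omega>) \<le> e (Suc n) - e (Suc (Suc n))" for n
  proof -
    let ?A = "\<lambda>k \<omega>. of_bool (unvisited X T k \<omega>) :: real"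
    have "\<P>(\<omega> in M. unvisited X T (Suc n) \<omega>) = (\<integral>\<omega>. ?A (Suc n) \<omega> \<partial>M)"
      by (rule expectation_unvisited[symmetric])
    also have "\<dots> = (\<integral>\<omega>. ?A (Suc n) \<omega>
        * (\<Sum>S'\<in>UNIV. trans_prob lam (X (Suc n) \<omega>) S' * (w (X (Suc n) \<omega>) - w S')) \<partial>M)"
    proof (intro Bochner_Integration.integral_cong refl)
      fix \<omega>
      show "?A (Suc n) \<omega> = ?A (Suc n) \<omega>
          * (\<Sum>S'\<in>UNIV. trans_prob lam (X (Suc n) \<omega>) S' * (w (X (Suc n) \<omega>) - w S'))"
      proof (cases "unvisited X T (Suc n) \<omega>")
        case True
        then have "X (Suc n) \<omega> \<noteq> T"
          by (simp add: unvisited_def)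
        from drop[OF this] show ?thesis by simp
      qed simp
    qed
    also have "\<dots> = (\<integral>\<omega>. ?A (Suc n) \<omega> * (w (X (Suc n) \<omega>) - w (X (Suc (Suc n)) \<omega>)) \<partial>M)"
      by (rule unvisited_step[symmetric])
    also have "\<dots> = e (Suc n) - (\<integral>\<omega>. ?A (Suc n) \<omega> * w (X (Suc (Suc n)) \<omega>) \<partial>M)"
      unfolding e_def right_diff_distrib
      by (rule Bochner_Integration.integral_diff)
         (rule bounded_integrable[where \<phi> = "\<lambda>S _. w S"])+
    also have "\<dots> \<le> e (Suc n) - e (Suc (Suc n))"
      unfolding e_def
      by (intro diff_left_mono integral_mono bounded_integrable[where \<phi> = "\<lambda>S _. w S"])
         (auto simp: unvisited_def w_nonneg)
    finally show ?thesis .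
  qed
  have "(\<Sum>n<N. \<P>(\<omega> in M. unvisited X T (Suc n) \<omega>)) \<le> e 1 - e (Suc N)" for N
  proof (induction N)
    case (Suc N)
    then show ?case using step[of N] by simp
  qed simp
  then have "(\<Sum>n<N. \<P>(\<omega> in M. unvisited X T (Suc n) \<omega>)) \<le> e 1" for N
    using e_nonneg[of "Suc N"] by (smt (verit))
  then have "summable (\<lambda>n. \<P>(\<omega> in M. unvisited X T (Suc n) \<omega>))"
    by (intro summableI_nonneg_bounded) auto
  then show ?thesis
    using summable_Suc_iff[of "\<lambda>n. \<P>(\<omega> in M. unvisited X T n \<omega>)"] by simp
qed

lemma AE_visit_time_finite: "AE \<omega> in M. visit_time X T \<omega> < \<infinity>"
proof -
  have "\<P>(\<omega> in M. \<forall>n. unvisited X T n \<omega>) \<le> \<P>(\<omega> in M. unvisited X T n \<omega>)" for n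
    by (intro finite_measure_mono) auto
  then have "\<P>(\<omega> in M. \<forall>n. unvisited X T n \<omega>) \<le> 0"
    by (intro LIMSEQ_le_const[OF summable_LIMSEQ_zero[OF summable_unvisited]]) auto
  then have "AE \<omega> in M. \<not> (\<forall>n. unvisited X T n \<omega>)"
    by (subst prob_Collect_eq_0[symmetric]) (auto simp: measure_le_0_iff)
  then show ?thesis
    unfolding visit_time_finite_iff by simp
qed

text \<open>The path sum is almost surely the series of the increments over the steps before the first
  visit. Integration term by term is justified by \<open>summable_unvisited\<close>, as the increments are
  bounded by \<open>c\<close>.\<close>

lemma path_sum_has_integral:
  fixes g :: "'v \<Rightarrow> 'v \<Rightarrow> real"
  shows integrable_path_sum: "integrable M (path_sum g X T)"
    and integral_path_sum: "(\<integral>\<omega>. path_sum g X T \<omega> \<partial>M)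
      = (\<Sum>n. \<integral>\<omega>. of_bool (unvisited X T n \<omega>) * g (X n \<omega>) (X (Suc n) \<omega>) \<partial>M)"
proof -
  let ?F = "\<lambda>n \<omega>. of_bool (unvisited X T n \<omega>) * g (X n \<omega>) (X (Suc n) \<omega>)"
  define c where "c = Max (range (\<lambda>(S, S'). \<bar>g S S'\<bar>))"
  have int: "integrable M (?F n)" for n
    by (rule bounded_integrable)
  have c: "\<bar>g S S'\<bar> \<le> c" for S S'
    unfolding c_def by (rule Max_ge) (auto intro!: image_eqI[of _ _ "(S, S')"])
  have sums: "summable (\<lambda>n. norm (?F n \<omega>)) \<and> (\<Sum>n. ?F n \<omega>) = path_sum g X T \<omega>"
    if "visit_time X T \<omega> < \<infinity>" for \<omega>
  proof -
    obtain m where m: "{n. unvisited X T n \<omega>} = {..<m}"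
      using unvisited_lessThan[OF \<open>visit_time X T \<omega> < \<infinity>\<close>] by blast
    then have iff: "unvisited X T n \<omega> \<longleftrightarrow> n < m" for n
      by auto
    have "summable (\<lambda>n. norm (?F n \<omega>))"
      by (rule summable_finite[of "{..<m}"]) (auto simp: iff)
    moreover have "(\<Sum>n. ?F n \<omega>) = (\<Sum>n<m. ?F n \<omega>)"
      by (rule suminf_finite) (auto simp: iff)
    moreover have "\<dots> = path_sum g X T \<omega>"
      by (simp add: path_sum_unvisited iff lessThan_def)
    ultimately show ?thesis by simp
  qed
  have AE_sum: "AE \<omega> in M. summable (\<lambda>n. norm (?F n \<omega>))"
    using AE_visit_time_finite by eventually_elim (use sums in blast)
  have AE_eq: "AE \<omega> in M. (\<Sum>n. ?F n \<omega>) = path_sum g X T \<omega>"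
    using AE_visit_time_finite by eventually_elim (use sums in blast)
  have summ: "summable (\<lambda>n. \<integral>\<omega>. norm (?F n \<omega>) \<partial>M)"
  proof (rule summable_comparison_test'[OF summable_mult[OF summable_unvisited[of T], of c]])
    fix n
    have "(\<integral>\<omega>. norm (?F n \<omega>) \<partial>M) \<le> (\<integral>\<omega>. of_bool (unvisited X T n \<omega>) * c \<partial>M)"
      using c
      by (intro integral_mono integrable_norm[OF int] bounded_integrable[where \<phi> = "\<lambda>_ _. c"])
         (auto simp: of_bool_def)
    also have "\<dots> = c * \<P>(\<omega> in M. unvisited X T n \<omega>)"
      by (simp add: expectation_unvisited mult.commute)
    finally show "norm (\<integral>\<omega>. norm (?F n \<omega>) \<partial>M) \<le> c * \<P>(\<omega> in M. unvisited X T n \<omega>)"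
      by simp
  qed
  \<comment> \<open>On paths that never visit \<open>T\<close>, the path sum is the default value of an infinite sum.\<close>
  have "path_sum g X T = (\<lambda>\<omega>. if \<forall>n. unvisited X T n \<omega> then 0 else \<Sum>n. ?F n \<omega>)"
  proof
    fix \<omega>
    show "path_sum g X T \<omega> = (if \<forall>n. unvisited X T n \<omega> then 0 else \<Sum>n. ?F n \<omega>)"
      using sums[of \<omega>] unfolding visit_time_finite_iff
      by (cases "\<forall>n. unvisited X T n \<omega>") (auto simp: path_sum_unvisited)
  qed
  then have [measurable]: "path_sum g X T \<in> borel_measurable M"
    by simp
  have suminf_int: "integrable M (\<lambda>\<omega>. \<Sum>n. ?F n \<omega>)"
    by (rule integrable_suminf[OF int AE_sum summ])
  show "integrable M (path_sum g X T)"
    using suminf_int by (rule integrable_cong_AE_imp) (use AE_eq in auto)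
  have "(\<integral>\<omega>. path_sum g X T \<omega> \<partial>M) = (\<integral>\<omega>. (\<Sum>n. ?F n \<omega>) \<partial>M)"
    using AE_eq by (intro integral_cong_AE) auto
  also have "\<dots> = (\<Sum>n. \<integral>\<omega>. ?F n \<omega> \<partial>M)"
    by (rule integral_suminf[OF int AE_sum summ])
  finally show "(\<integral>\<omega>. path_sum g X T \<omega> \<partial>M) = (\<Sum>n. \<integral>\<omega>. ?F n \<omega> \<partial>M)" .
qed

text \<open>Optional stopping for the martingale with increments \<open>g (X n) (X (n + 1))\<close>.\<close>

lemma expected_path_sum_eq_0:
  assumes "\<And>S. (\<Sum>S'\<in>UNIV. trans_prob lam S S' * g S S') = 0"
  shows "(\<integral>\<omega>. path_sum g X T \<omega> \<partial>M) = 0"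
  by (simp add: integral_path_sum unvisited_step assms)

lemma path_potential_eq:
  assumes f: "edge_flow E f" and u: "laplacian lam u = divergence lam f" and u0: "u s0 = 0"
  shows "path_potential M X f = u"
proof
  fix T
  define g where "g S S' = f S S' - gradient u S S'" for S S'
  have g: "(\<Sum>S'\<in>UNIV. trans_prob lam S S' * g S S') = 0" for S
    using expected_flow[OF f, of S] expected_flow[OF edge_flow_gradient[of E u], of S] u
    by (simp add: g_def right_diff_distrib sum_subtractf laplacian_def)
  have "path_sum f X T \<omega> = path_sum g X T \<omega> + path_sum (gradient u) X T \<omega>" for \<omega>
    by (simp add: path_sum_def g_def sum.distrib[symmetric])
  then have "path_potential M X f T
      = (\<integral>\<omega>. path_sum g X T \<omega> \<partial>M) + (\<integral>\<omega>. path_sum (gradient u) X T \<omega> \<partial>M)"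
    by (simp add: path_potential_def integrable_path_sum)
  also have "(\<integral>\<omega>. path_sum g X T \<omega> \<partial>M) = 0"
    by (rule expected_path_sum_eq_0[OF g])
  also have "(\<integral>\<omega>. path_sum (gradient u) X T \<omega> \<partial>M) = (\<integral>\<omega>. u T \<partial>M)"
  proof (rule integral_cong_AE)
    have "AE \<omega> in M. X 0 \<omega> = s0"
      using chain by (simp add: markov_chain_def)
    with AE_visit_time_finite[of T] show "AE \<omega> in M. path_sum (gradient u) X T \<omega> = u T"
      by eventually_elim (simp add: path_sum_gradient u0)
  qed (use integrable_path_sum in auto)
  finally show "path_potential M X f T = u T"
    by (simp add: prob_space)
qed

end

theorem theorem7p1:
  fixes E :: "('v::finite \<times> 'v) set" and lam :: "'v \<Rightarrow> 'v \<Rightarrow> real" and s0 :: 'v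
    and M :: "'w measure" and X :: "nat \<Rightarrow> 'w \<Rightarrow> 'v" and f :: "'v \<Rightarrow> 'v \<Rightarrow> real"
  assumes "weighted_graph E lam"
    and "connected_graph E"
    and "\<And>S. nbrs lam S \<noteq> {}"
    and "markov_chain M X s0 (trans_prob lam)"
    and "edge_flow E f"
  shows "(\<forall>T. (AE \<omega> in M. visit_time X T \<omega> < \<infinity>) \<and> integrable M (path_sum f X T)) \<and>
    (laplacian lam (path_potential M X f) = divergence lam f \<and> path_potential M X f s0 = 0) \<and>
    (\<forall>u. laplacian lam u = divergence lam f \<and> u s0 = 0 \<longrightarrow> u = path_potential M X f)"
proof -
  interpret weighted_graph E lam by fact
  interpret prob_space M
    using assms(4) by (simp add: markov_chain_def)
  interpret network_walk E lam M X s0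
    by unfold_locales (use assms in auto)
  obtain u where "laplacian lam u = divergence lam f" "u s0 = 0"
    using poisson_solvable[OF assms(2) sum_divergence_eq_0[OF assms(5)]] by blast
  moreover from this have "path_potential M X f = u"
    by (rule path_potential_eq[OF assms(5)])
  ultimately show ?thesis
    using AE_visit_time_finite integrable_path_sum path_potential_eq[OF assms(5)] by blast
qed

end
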